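(* Let $s\ge 1$, let $A_1,\ldots,A_s$ be commutative rings without non-trivial idempotents, let $A=A_1\oplus\cdots\oplus A_s$ be their direct sum, and let $X$ be an arbitrary (possibly infinite) set of commuting variables. Then the idempotents $a(X)$ of the matrix ring $M_2(A[[X]])$ are exactly the matrices obtained by the following procedure. Split the index set $\{1,\ldots,s\}$ into a disjoint union of three (possibly empty) parts $P$, $Q$, $R$, and write $A=A_P\oplus A_Q\oplus A_R$, where $$A_P=\bigoplus_{p\in P}A_p,\qquad A_Q=\bigoplus_{q\in Q}A_q,\qquad A_R=\bigoplus_{r\in R}A_r.$$ Choose power series $\alpha(X),\beta(X),\gamma(X)\in A_P[[X]]$ such that $\alpha(X)(1-\alpha(X))=\beta(X)\gamma(X)$. Then set $a(X)=(a_P(X),I_2,0_2)$, where $$a_P(X)=\begin{pmatrix}\alpha(X)&\beta(X)\\ \gamma(X)&1-\alpha(X)\end{pmatrix}\in M_2(A_P[[X]]),$$ $I_2\in M_2(A_Q[[X]])$ is the identity matrix and $0_2\in M_2(A_R[[X]])$ is the zero matrix.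
   Context: All rings are associative with unit. An element $a$ of a ring is an idempotent if $a^2=a$; an idempotent is trivial if it equals $0$ or $1$, and a ring is "without non-trivial idempotents" if its only idempotents are $0$ and $1$. For a commutative ring $A$ and a set $X$ of commuting variables, $A[[X]]$ denotes the ring of formal power series in $X$ with coefficients in $A$. $M_2(B)$ denotes the ring of $2\times2$ matrices over a commutative ring $B$. The decomposition $A=A_P\oplus A_Q\oplus A_R$ induces the identification $M_2(A[[X]])=M_2(A_P[[X]])\oplus M_2(A_Q[[X]])\oplus M_2(A_R[[X]])$, and triples such as $(a_P(X),I_2,0_2)$ are understood via this identification. A direct sum over an empty index set is the zero ring. *)

theory Defs
  imports "HOL-Algebra.Ring" "HOL-Library.FuncSet" "HOL-Library.Multiset"
    "Jordan_Normal_Form.Matrix"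
begin

definition idempotents :: "('a, 'm) ring_scheme \<Rightarrow> 'a set" where
  "idempotents R = {e \<in> carrier R. e \<otimes>\<^bsub>R\<^esub> e = e}"

definition no_nontrivial_idempotents :: "('a, 'm) ring_scheme \<Rightarrow> bool" where
  "no_nontrivial_idempotents R \<longleftrightarrow> idempotents R = {\<zero>\<^bsub>R\<^esub>, \<one>\<^bsub>R\<^esub>}"

text \<open>All index sets used below are finite, so the direct sum is the full product. For the empty
  index set the carrier is a singleton, i.e. the ring is the zero ring.\<close>

definition direct_sum_ring :: "'i set \<Rightarrow> ('i \<Rightarrow> ('a, 'm) ring_scheme) \<Rightarrow> ('i \<Rightarrow> 'a) ring" where
  "direct_sum_ring I A = \<lparr>
     carrier = (\<Pi>\<^sub>E i\<in>I. carrier (A i)),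
     mult = (\<lambda>f g. \<lambda>i\<in>I. f i \<otimes>\<^bsub>A i\<^esub> g i),
     one = (\<lambda>i\<in>I. \<one>\<^bsub>A i\<^esub>),
     zero = (\<lambda>i\<in>I. \<zero>\<^bsub>A i\<^esub>),
     add = (\<lambda>f g. \<lambda>i\<in>I. f i \<oplus>\<^bsub>A i\<^esub> g i)\<rparr>"

text \<open>A monomial in the commuting variables \<open>X\<close> is the finite multiset of its variables; the product
  of monomials is the sum of multisets and \<open>{#}\<close> is the monomial \<open>1\<close>. A power series is the family
  of its coefficients.\<close>

definition monomials :: "'x set \<Rightarrow> 'x multiset set" where
  "monomials X = {m. set_mset m \<subseteq> X}"

definition power_series_ring :: "('a, 'm) ring_scheme \<Rightarrow> 'x set \<Rightarrow> ('x multiset \<Rightarrow> 'a) ring" where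
  "power_series_ring A X = \<lparr>
     carrier = monomials X \<rightarrow>\<^sub>E carrier A,
     mult = (\<lambda>f g. \<lambda>m\<in>monomials X.
       \<Oplus>\<^bsub>A\<^esub>p\<in>{(u, v). u + v = m}. f (fst p) \<otimes>\<^bsub>A\<^esub> g (snd p)),
     one = (\<lambda>m\<in>monomials X. if m = {#} then \<one>\<^bsub>A\<^esub> else \<zero>\<^bsub>A\<^esub>),
     zero = (\<lambda>m\<in>monomials X. \<zero>\<^bsub>A\<^esub>),
     add = (\<lambda>f g. \<lambda>m\<in>monomials X. f m \<oplus>\<^bsub>A\<^esub> g m)\<rparr>"

text \<open>The sum defining a coefficient of a product is finite, also for infinite \<open>X\<close>.\<close>

lemma finite_mset_splittings: "finite {(u, v). u + v = (m :: 'x multiset)}"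
proof -
  have "u \<in> mset ` {xs. set xs \<subseteq> set_mset m \<and> length xs \<le> size m}" if "u \<subseteq># m" for u
  proof -
    obtain xs where "u = mset xs"
      by (metis ex_mset)
    with that show ?thesis
      using set_mset_mono[OF that] size_mset_mono[OF that] by auto
  qed
  then have "{u. u \<subseteq># m} \<subseteq> mset ` {xs. set xs \<subseteq> set_mset m \<and> length xs \<le> size m}"
    by blast
  then have "finite {u. u \<subseteq># m}"
    by (rule finite_subset) (simp add: finite_lists_length_le)
  moreover have "{(u, v). u + v = m} \<subseteq> (\<lambda>u. (u, m - u)) ` {u. u \<subseteq># m}"
    by auto
  ultimately show ?thesis
    by (meson finite_imageI finite_subset)
qed

definition matrix_ring :: "nat \<Rightarrow> ('b, 'm) ring_scheme \<Rightarrow> 'b mat ring" where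
  "matrix_ring n B = \<lparr>
     carrier = {M \<in> carrier_mat n n. elements_mat M \<subseteq> carrier B},
     mult = (\<lambda>M N. mat n n (\<lambda>(i, j). \<Oplus>\<^bsub>B\<^esub>k\<in>{..<n}. M $$ (i, k) \<otimes>\<^bsub>B\<^esub> N $$ (k, j))),
     one = mat n n (\<lambda>(i, j). if i = j then \<one>\<^bsub>B\<^esub> else \<zero>\<^bsub>B\<^esub>),
     zero = mat n n (\<lambda>(i, j). \<zero>\<^bsub>B\<^esub>),
     add = (\<lambda>M N. mat n n (\<lambda>(i, j). M $$ (i, j) \<oplus>\<^bsub>B\<^esub> N $$ (i, j)))\<rparr>"

text \<open>For pairwise disjoint \<open>P\<close>, \<open>Q\<close>, \<open>R\<close>, the following three functions send a triple to the
  corresponding element under the identifications \<open>A\<^sub>P \<oplus> A\<^sub>Q \<oplus> A\<^sub>R = A\<close>,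
  \<open>A\<^sub>P[[X]] \<oplus> A\<^sub>Q[[X]] \<oplus> A\<^sub>R[[X]] = A[[X]]\<close> (coefficientwise) and
  \<open>M\<^sub>2(A\<^sub>P[[X]]) \<oplus> M\<^sub>2(A\<^sub>Q[[X]]) \<oplus> M\<^sub>2(A\<^sub>R[[X]]) = M\<^sub>2(A[[X]])\<close> (entrywise), where \<open>A\<close> is the direct
  sum over \<open>P \<union> Q \<union> R\<close>.\<close>

definition triple_elem ::
  "'i set \<Rightarrow> 'i set \<Rightarrow> 'i set \<Rightarrow> ('i \<Rightarrow> 'a) \<Rightarrow> ('i \<Rightarrow> 'a) \<Rightarrow> ('i \<Rightarrow> 'a) \<Rightarrow> ('i \<Rightarrow> 'a)" where
  "triple_elem P Q R x y z =
     (\<lambda>i\<in>P \<union> Q \<union> R. if i \<in> P then x i else if i \<in> Q then y i else z i)"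

definition triple_series ::
  "'x set \<Rightarrow> 'i set \<Rightarrow> 'i set \<Rightarrow> 'i set \<Rightarrow> ('x multiset \<Rightarrow> 'i \<Rightarrow> 'a) \<Rightarrow> ('x multiset \<Rightarrow> 'i \<Rightarrow> 'a)
    \<Rightarrow> ('x multiset \<Rightarrow> 'i \<Rightarrow> 'a) \<Rightarrow> ('x multiset \<Rightarrow> 'i \<Rightarrow> 'a)" where
  "triple_series X P Q R f g h = (\<lambda>m\<in>monomials X. triple_elem P Q R (f m) (g m) (h m))"

definition triple_matrix ::
  "'x set \<Rightarrow> 'i set \<Rightarrow> 'i set \<Rightarrow> 'i set \<Rightarrow> ('x multiset \<Rightarrow> 'i \<Rightarrow> 'a) mat
    \<Rightarrow> ('x multiset \<Rightarrow> 'i \<Rightarrow> 'a) mat \<Rightarrow> ('x multiset \<Rightarrow> 'i \<Rightarrow> 'a) mat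
    \<Rightarrow> ('x multiset \<Rightarrow> 'i \<Rightarrow> 'a) mat" where
  "triple_matrix X P Q R K L M =
     mat 2 2 (\<lambda>(i, j). triple_series X P Q R (K $$ (i, j)) (L $$ (i, j)) (M $$ (i, j)))"

end

theory Submission
  imports Defs
begin

text \<open>Evaluating all coefficients at an index \<open>i\<close> is a ring homomorphism from the power series over a
  direct sum to the power series over the \<open>i\<close>-th summand, and a series is determined by its images
  for all \<open>i\<close> (\<open>direct_sum_series_eqI\<close>). Idempotency of a matrix is a system of polynomial equations
  in its entries, so it can be tested in each summand separately
  (\<open>idempotent_entries_componentwise\<close>), and the problem is reduced to a single ring \<open>A\<^sub>i\<close>.

  There the power series ring again has only trivial idempotents, because an idempotent series
  whose constant coefficient is \<open>0\<close> or \<open>1\<close> equals that constant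
  (\<open>power_series_no_nontrivial_idempotents\<close>). Over a
  commutative ring with only trivial idempotents, the determinant of an idempotent two-by-two matrix
  is \<open>0\<close> or \<open>1\<close>. It is \<open>1\<close> only for the identity matrix. If it is \<open>0\<close>, the trace is idempotent as
  well, being \<open>0\<close> only for the zero matrix, and being \<open>1\<close> exactly for the matrices with diagonal
  \<open>\<alpha>\<close>, \<open>1 - \<alpha>\<close> and off-diagonal entries satisfying \<open>\<alpha> (1 - \<alpha>) = \<beta> \<gamma>\<close>
  (\<open>idempotent_entries_cases\<close>). The sets \<open>P\<close>, \<open>Q\<close>, \<open>R\<close> record which of the three alternatives occurs
  at which index (\<open>idempotent_eq_block_idempotent\<close>).\<close>

section \<open>Direct sums\<close>

lemma direct_sum_ring_simps:
  "carrier (direct_sum_ring I A) = (\<Pi>\<^sub>E i\<in>I. carrier (A i))"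
  "f \<otimes>\<^bsub>direct_sum_ring I A\<^esub> g = (\<lambda>i\<in>I. f i \<otimes>\<^bsub>A i\<^esub> g i)"
  "f \<oplus>\<^bsub>direct_sum_ring I A\<^esub> g = (\<lambda>i\<in>I. f i \<oplus>\<^bsub>A i\<^esub> g i)"
  "\<one>\<^bsub>direct_sum_ring I A\<^esub> = (\<lambda>i\<in>I. \<one>\<^bsub>A i\<^esub>)"
  "\<zero>\<^bsub>direct_sum_ring I A\<^esub> = (\<lambda>i\<in>I. \<zero>\<^bsub>A i\<^esub>)"
  by (simp_all add: direct_sum_ring_def)

lemma direct_sum_ring_cring:
  assumes "\<And>i. i \<in> I \<Longrightarrow> cring (A i)"
  shows "cring (direct_sum_ring I A)"
proof -
  have ring: "ring (A i)" if "i \<in> I" for i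
    using assms[OF that] by (rule cring.axioms)
  note R = ring.ring_simprules[OF ring] and C = cring.cring_simprules[OF assms]
  show ?thesis
  proof (rule cringI)
    show "abelian_group (direct_sum_ring I A)"
    proof (rule abelian_groupI)
      fix x assume x: "x \<in> carrier (direct_sum_ring I A)"
      show "\<exists>y\<in>carrier (direct_sum_ring I A).
          y \<oplus>\<^bsub>direct_sum_ring I A\<^esub> x = \<zero>\<^bsub>direct_sum_ring I A\<^esub>"
        using x by (intro bexI[of _ "\<lambda>i\<in>I. \<ominus>\<^bsub>A i\<^esub> x i"])
          (auto simp: direct_sum_ring_simps PiE_iff R intro!: restrict_ext)
    qed (auto simp: direct_sum_ring_simps PiE_iff R fun_eq_iff restrict_def extensional_def)
    show "comm_monoid (direct_sum_ring I A)"
      by (rule comm_monoidI)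
        (auto simp: direct_sum_ring_simps PiE_iff C
          monoid.r_one[OF ring.is_monoid[OF ring]] fun_eq_iff restrict_def extensional_def)
  qed (auto simp: direct_sum_ring_simps PiE_iff R intro!: restrict_ext)
qed

lemma direct_sum_ring_component_hom:
  assumes "i \<in> I"
  shows "(\<lambda>x. x i) \<in> ring_hom (direct_sum_ring I A) (A i)"
  using assms by (intro ring_hom_memI) (auto simp: direct_sum_ring_simps)

section \<open>Power series\<close>

abbreviation splittings :: "'x multiset \<Rightarrow> ('x multiset \<times> 'x multiset) set" where
  "splittings m \<equiv> {(u, v). u + v = m}"

lemma splittings_monomials:
  assumes "p \<in> splittings m" "m \<in> monomials X"
  shows "fst p \<in> monomials X" "snd p \<in> monomials X"
  using assms by (auto simp: monomials_def)

lemma empty_in_monomials: "{#} \<in> monomials X"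
  by (simp add: monomials_def)

lemma (in abelian_monoid) finsum_Sigma:
  assumes "finite I" "\<And>i. i \<in> I \<Longrightarrow> finite (J i)"
    and "\<And>i j. i \<in> I \<Longrightarrow> j \<in> J i \<Longrightarrow> f i j \<in> carrier G"
  shows "(\<Oplus>i\<in>I. \<Oplus>j\<in>J i. f i j) = (\<Oplus>p\<in>Sigma I J. f (fst p) (snd p))"
proof -
  have "Sigma I J = (\<Union>i\<in>I. Pair i ` J i)"
    by auto
  then have "(\<Oplus>p\<in>Sigma I J. f (fst p) (snd p)) = (\<Oplus>p\<in>(\<Union>i\<in>I. Pair i ` J i). f (fst p) (snd p))"
    by simp
  also have "\<dots> = (\<Oplus>i\<in>I. \<Oplus>p\<in>Pair i ` J i. f (fst p) (snd p))"
    using assms by (intro add.finprod_UN_disjoint) (auto simp: pairwise_def disjnt_def)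
  also have "\<dots> = (\<Oplus>i\<in>I. \<Oplus>j\<in>J i. f i j)"
  proof (rule finsum_cong'[OF refl])
    fix i assume i: "i \<in> I"
    show "(\<Oplus>p\<in>Pair i ` J i. f (fst p) (snd p)) = (\<Oplus>j\<in>J i. f i j)"
      using assms(3)[OF i] by (subst finsum_reindex) (auto simp: inj_on_def)
  qed (use assms(3) in \<open>auto intro!: finsum_closed\<close>)
  finally show ?thesis by simp
qed

text \<open>Both double sums run over the ways of writing \<open>m = a + b + c\<close>; the left one splits off \<open>c\<close>
  first, the right one splits off \<open>a\<close> first. This is the associativity of the Cauchy product.\<close>

lemma (in abelian_monoid) finsum_splittings_assoc:
  assumes "\<And>a b c. a + b + c = m \<Longrightarrow> F a b c \<in> carrier G"
  shows "(\<Oplus>p\<in>splittings m. \<Oplus>q\<in>splittings (fst p). F (fst q) (snd q) (snd p)) =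
    (\<Oplus>p\<in>splittings m. \<Oplus>q\<in>splittings (snd p). F (fst p) (fst q) (snd q))"
proof -
  let ?L = "Sigma (splittings m) (\<lambda>p. splittings (fst p))"
  let ?R = "Sigma (splittings m) (\<lambda>p. splittings (snd p))"
  let ?h = "\<lambda>((w, c), (a, b)). ((a, b + c), (b, c))"
  have inj: "inj_on ?h ?L"
    by (auto simp: inj_on_def)
  have im: "?h ` ?L = ?R"
  proof
    show "?R \<subseteq> ?h ` ?L"
    proof
      fix z assume "z \<in> ?R"
      then obtain a b c where "z = ((a, b + c), (b, c))" "a + (b + c) = m"
        by auto
      then show "z \<in> ?h ` ?L"
        by (intro image_eqI[of _ _ "((a + b, c), (a, b))"]) (auto simp: add.assoc)
    qed
  qed (auto simp: add.assoc)
  have "(\<Oplus>p\<in>splittings m. \<Oplus>q\<in>splittings (snd p). F (fst p) (fst q) (snd q)) =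
      (\<Oplus>z\<in>?h ` ?L. F (fst (fst z)) (fst (snd z)) (snd (snd z)))"
    unfolding im using assms
    by (intro finsum_Sigma) (auto simp: finite_mset_splittings add.assoc)
  also have "\<dots> = (\<Oplus>z\<in>?L. F (fst (snd z)) (snd (snd z)) (snd (fst z)))"
    by (subst finsum_reindex[OF _ inj], unfold im)
      (use assms in \<open>auto simp: case_prod_beta add.assoc intro!: finsum_cong'\<close>)
  also have "\<dots> = (\<Oplus>p\<in>splittings m. \<Oplus>q\<in>splittings (fst p). F (fst q) (snd q) (snd p))"
    using assms by (intro finsum_Sigma[symmetric]) (auto simp: finite_mset_splittings)
  finally show ?thesis by simp
qed

lemma (in abelian_monoid) finsum_splittings_swap:
  assumes "\<And>a b. a + b = m \<Longrightarrow> F a b \<in> carrier G"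
  shows "(\<Oplus>p\<in>splittings m. F (fst p) (snd p)) = (\<Oplus>p\<in>splittings m. F (snd p) (fst p))"
proof -
  have im: "prod.swap ` splittings m = splittings m"
    by (auto simp: image_iff add.commute)
  have "(\<Oplus>p\<in>splittings m. F (fst p) (snd p)) = (\<Oplus>p\<in>prod.swap ` splittings m. F (fst p) (snd p))"
    by (simp add: im)
  also have "\<dots> = (\<Oplus>p\<in>splittings m. F (snd p) (fst p))"
    by (subst finsum_reindex, unfold im) (use assms in \<open>auto simp: inj_on_def\<close>)
  finally show ?thesis .
qed

lemma power_series_ring_simps:
  "carrier (power_series_ring A X) = monomials X \<rightarrow>\<^sub>E carrier A"
  "f \<otimes>\<^bsub>power_series_ring A X\<^esub> g = (\<lambda>m\<in>monomials X.
     \<Oplus>\<^bsub>A\<^esub>p\<in>splittings m. f (fst p) \<otimes>\<^bsub>A\<^esub> g (snd p))"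
  "f \<oplus>\<^bsub>power_series_ring A X\<^esub> g = (\<lambda>m\<in>monomials X. f m \<oplus>\<^bsub>A\<^esub> g m)"
  "\<one>\<^bsub>power_series_ring A X\<^esub> = (\<lambda>m\<in>monomials X. if m = {#} then \<one>\<^bsub>A\<^esub> else \<zero>\<^bsub>A\<^esub>)"
  "\<zero>\<^bsub>power_series_ring A X\<^esub> = (\<lambda>m\<in>monomials X. \<zero>\<^bsub>A\<^esub>)"
  by (simp_all add: power_series_ring_def)

lemma power_series_eqI:
  assumes "f \<in> carrier (power_series_ring A X)" "g \<in> carrier (power_series_ring A X)"
    and "\<And>m. m \<in> monomials X \<Longrightarrow> f m = g m"
  shows "f = g"
  using assms by (auto simp: power_series_ring_simps intro: PiE_ext)

context cring
begin

lemma power_series_coeff_closed: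
  assumes "f \<in> carrier (power_series_ring R X)" "m \<in> monomials X"
  shows "f m \<in> carrier R"
  using assms by (auto simp: power_series_ring_simps)

lemma power_series_product_closed:
  assumes "f \<in> carrier (power_series_ring R X)" "g \<in> carrier (power_series_ring R X)"
    and "m \<in> monomials X" "a + b = m"
  shows "f a \<otimes> g b \<in> carrier R"
  using assms splittings_monomials[of "(a, b)" m X]
  by (intro m_closed power_series_coeff_closed[of _ X]) auto

lemma power_series_mult_closed:
  assumes "f \<in> carrier (power_series_ring R X)" "g \<in> carrier (power_series_ring R X)"
  shows "f \<otimes>\<^bsub>power_series_ring R X\<^esub> g \<in> carrier (power_series_ring R X)"
  using power_series_product_closed[OF assms]
  by (auto simp: power_series_ring_simps(1,2) intro!: finsum_closed)

lemma power_series_mult_assoc: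
  assumes f: "f \<in> carrier (power_series_ring R X)" and g: "g \<in> carrier (power_series_ring R X)"
    and h: "h \<in> carrier (power_series_ring R X)"
  shows "f \<otimes>\<^bsub>power_series_ring R X\<^esub> g \<otimes>\<^bsub>power_series_ring R X\<^esub> h =
    f \<otimes>\<^bsub>power_series_ring R X\<^esub> (g \<otimes>\<^bsub>power_series_ring R X\<^esub> h)"
proof (rule power_series_eqI[of _ R X])
  fix m assume m: "m \<in> monomials X"
  have sub: "a \<in> monomials X \<and> b \<in> monomials X \<and> c \<in> monomials X \<and> a + b \<in> monomials X \<and>
      b + c \<in> monomials X" if "a + b + c = m" for a b c
    using m that by (auto simp: monomials_def)
  have cl: "f a \<in> carrier R" "g b \<in> carrier R" "h c \<in> carrier R" if "a + b + c = m" for a b c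
    using sub[OF that] f g h by (auto intro!: power_series_coeff_closed)
  have "(f \<otimes>\<^bsub>power_series_ring R X\<^esub> g \<otimes>\<^bsub>power_series_ring R X\<^esub> h) m =
      (\<Oplus>p\<in>splittings m. (\<Oplus>q\<in>splittings (fst p). f (fst q) \<otimes> g (snd q)) \<otimes> h (snd p))"
    using m sub[of _ "{#}"] cl cl[of _ "{#}"]
    by (auto simp: power_series_ring_simps(2) Pi_def intro!: finsum_cong' finsum_closed m_closed)
  also have "\<dots> =
      (\<Oplus>p\<in>splittings m. \<Oplus>q\<in>splittings (fst p). f (fst q) \<otimes> g (snd q) \<otimes> h (snd p))"
    using cl cl[of _ "{#}"]
    by (auto simp: Pi_def intro!: finsum_cong' finsum_ldistr finite_mset_splittings finsum_closed)
  also have "\<dots> = (\<Oplus>p\<in>splittings m. \<Oplus>q\<in>splittings (snd p). f (fst p) \<otimes> g (fst q) \<otimes> h (snd q))"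
    using cl by (intro finsum_splittings_assoc[where F = "\<lambda>a b c. f a \<otimes> g b \<otimes> h c"]) auto
  also have "\<dots> =
      (\<Oplus>p\<in>splittings m. f (fst p) \<otimes> (\<Oplus>q\<in>splittings (snd p). g (fst q) \<otimes> h (snd q)))"
  proof (rule finsum_cong'[OF refl])
    fix p assume p: "p \<in> splittings m"
    then have cl': "f (fst p) \<in> carrier R" "g b \<in> carrier R" "h c \<in> carrier R"
      if "b + c = snd p" for b c
      using that cl[of "fst p" b c] by (auto simp: add.assoc)
    have "(\<Oplus>q\<in>splittings (snd p). f (fst p) \<otimes> g (fst q) \<otimes> h (snd q)) =
        (\<Oplus>q\<in>splittings (snd p). f (fst p) \<otimes> (g (fst q) \<otimes> h (snd q)))"
      using cl' by (intro finsum_cong') (auto simp: m_assoc)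
    also have "\<dots> = f (fst p) \<otimes> (\<Oplus>q\<in>splittings (snd p). g (fst q) \<otimes> h (snd q))"
      using cl' cl'[of "{#}" "snd p"]
      by (intro finsum_rdistr[symmetric] finite_mset_splittings) auto
    finally show "(\<Oplus>q\<in>splittings (snd p). f (fst p) \<otimes> g (fst q) \<otimes> h (snd q)) =
        f (fst p) \<otimes> (\<Oplus>q\<in>splittings (snd p). g (fst q) \<otimes> h (snd q))" .
  next
    show "(\<lambda>p. f (fst p) \<otimes> (\<Oplus>q\<in>splittings (snd p). g (fst q) \<otimes> h (snd q)))
        \<in> splittings m \<rightarrow> carrier R"
      using cl cl[of _ _ "{#}"]
      by (auto simp: add.assoc[symmetric] intro!: m_closed finsum_closed)
  qed
  also have "\<dots> = (f \<otimes>\<^bsub>power_series_ring R X\<^esub> (g \<otimes>\<^bsub>power_series_ring R X\<^esub> h)) m"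
    using m sub[of "{#}"] cl cl[of _ _ "{#}"]
    by (auto simp: power_series_ring_simps(2) Pi_def add.assoc[symmetric]
        intro!: finsum_cong' finsum_closed m_closed)
  finally show "(f \<otimes>\<^bsub>power_series_ring R X\<^esub> g \<otimes>\<^bsub>power_series_ring R X\<^esub> h) m =
    (f \<otimes>\<^bsub>power_series_ring R X\<^esub> (g \<otimes>\<^bsub>power_series_ring R X\<^esub> h)) m" .
qed (intro power_series_mult_closed f g h)+

lemma power_series_mult_comm:
  assumes f: "f \<in> carrier (power_series_ring R X)" and g: "g \<in> carrier (power_series_ring R X)"
  shows "f \<otimes>\<^bsub>power_series_ring R X\<^esub> g = g \<otimes>\<^bsub>power_series_ring R X\<^esub> f"
proof (rule power_series_eqI[of _ R X])
  fix m assume m: "m \<in> monomials X"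
  have "(\<Oplus>p\<in>splittings m. f (fst p) \<otimes> g (snd p)) = (\<Oplus>p\<in>splittings m. f (snd p) \<otimes> g (fst p))"
    using power_series_product_closed[OF f g m]
    by (intro finsum_splittings_swap[where F = "\<lambda>a b. f a \<otimes> g b"]) auto
  also have "\<dots> = (\<Oplus>p\<in>splittings m. g (fst p) \<otimes> f (snd p))"
    using power_series_product_closed[OF g f m] splittings_monomials[OF _ m]
    by (intro finsum_cong')
      (auto intro!: m_comm power_series_coeff_closed[OF f] power_series_coeff_closed[OF g])
  finally show "(f \<otimes>\<^bsub>power_series_ring R X\<^esub> g) m = (g \<otimes>\<^bsub>power_series_ring R X\<^esub> f) m"
    using m by (simp add: power_series_ring_simps(2))
qed (intro power_series_mult_closed f g)+

lemma power_series_one_mult: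
  fixes f :: "'x multiset \<Rightarrow> 'a"
  assumes f: "f \<in> carrier (power_series_ring R X)"
  shows "\<one>\<^bsub>power_series_ring R X\<^esub> \<otimes>\<^bsub>power_series_ring R X\<^esub> f = f"
proof (rule power_series_eqI[of _ R X])
  fix m assume m: "m \<in> monomials X"
  let ?g = "\<lambda>p :: 'x multiset \<times> 'x multiset. (if fst p = {#} then \<one> else \<zero>) \<otimes> f (snd p)"
  have cl: "f v \<in> carrier R" if "u + v = m" for u v
    using that m f by (auto simp: monomials_def intro!: power_series_coeff_closed)
  have "(\<one>\<^bsub>power_series_ring R X\<^esub> \<otimes>\<^bsub>power_series_ring R X\<^esub> f) m = (\<Oplus>p\<in>splittings m. ?g p)"
    using m cl splittings_monomials[OF _ m]
    by (auto simp: power_series_ring_simps intro!: finsum_cong')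
  also have "\<dots> = (\<Oplus>p\<in>{({#}, m)}. ?g p)"
    using cl by (intro add.finprod_mono_neutral_cong_right) (auto simp: finite_mset_splittings)
  also have "\<dots> = f m"
    using cl[of "{#}" m] by (simp add: finsum_insert)
  finally show "(\<one>\<^bsub>power_series_ring R X\<^esub> \<otimes>\<^bsub>power_series_ring R X\<^esub> f) m = f m" .
next
  show "\<one>\<^bsub>power_series_ring R X\<^esub> \<otimes>\<^bsub>power_series_ring R X\<^esub> f \<in> carrier (power_series_ring R X)"
    by (rule power_series_mult_closed[OF _ f]) (auto simp: power_series_ring_simps)
qed (rule f)

lemma power_series_distrib:
  assumes f: "f \<in> carrier (power_series_ring R X)" and g: "g \<in> carrier (power_series_ring R X)"
    and h: "h \<in> carrier (power_series_ring R X)"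
  shows "(f \<oplus>\<^bsub>power_series_ring R X\<^esub> g) \<otimes>\<^bsub>power_series_ring R X\<^esub> h =
    f \<otimes>\<^bsub>power_series_ring R X\<^esub> h \<oplus>\<^bsub>power_series_ring R X\<^esub> g \<otimes>\<^bsub>power_series_ring R X\<^esub> h"
  unfolding power_series_ring_simps(2,3)
proof (rule restrict_ext)
  fix m assume m: "m \<in> monomials X"
  have cl: "f u \<in> carrier R" "g u \<in> carrier R" "h v \<in> carrier R" "u \<in> monomials X"
    if "u + v = m" for u v
    using that m f g h by (auto simp: monomials_def intro!: power_series_coeff_closed)
  have "(\<Oplus>p\<in>splittings m. (\<lambda>m\<in>monomials X. f m \<oplus> g m) (fst p) \<otimes> h (snd p)) =
      (\<Oplus>p\<in>splittings m. f (fst p) \<otimes> h (snd p) \<oplus> g (fst p) \<otimes> h (snd p))"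
    using cl by (intro finsum_cong') (auto simp: l_distr)
  also have "\<dots> = (\<Oplus>p\<in>splittings m. f (fst p) \<otimes> h (snd p)) \<oplus>
      (\<Oplus>p\<in>splittings m. g (fst p) \<otimes> h (snd p))"
    using cl by (intro finsum_addf) auto
  finally show "(\<Oplus>p\<in>splittings m. (\<lambda>m\<in>monomials X. f m \<oplus> g m) (fst p) \<otimes> h (snd p)) =
      (\<lambda>m\<in>monomials X. \<Oplus>p\<in>splittings m. f (fst p) \<otimes> h (snd p)) m \<oplus>
      (\<lambda>m\<in>monomials X. \<Oplus>p\<in>splittings m. g (fst p) \<otimes> h (snd p)) m"
    using m by simp
qed

lemma power_series_ring_cring: "cring (power_series_ring R X)"
proof (rule cringI)
  show "abelian_group (power_series_ring R X)"
  proof (rule abelian_groupI)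
    fix f assume f: "f \<in> carrier (power_series_ring R X)"
    show "\<exists>g\<in>carrier (power_series_ring R X).
        g \<oplus>\<^bsub>power_series_ring R X\<^esub> f = \<zero>\<^bsub>power_series_ring R X\<^esub>"
      using f by (intro bexI[of _ "\<lambda>m\<in>monomials X. \<ominus> f m"])
        (auto simp: power_series_ring_simps PiE_iff l_neg intro!: restrict_ext)
  qed (auto simp: power_series_ring_simps PiE_iff a_ac fun_eq_iff restrict_def extensional_def)
  show "comm_monoid (power_series_ring R X)"
    by (rule comm_monoidI)
      (auto intro: power_series_mult_closed power_series_mult_assoc power_series_mult_comm
        power_series_one_mult, auto simp: power_series_ring_simps)
qed (rule power_series_distrib)

end

definition map_series :: "'x set \<Rightarrow> ('a \<Rightarrow> 'b) \<Rightarrow> ('x multiset \<Rightarrow> 'a) \<Rightarrow> ('x multiset \<Rightarrow> 'b)" where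
  "map_series X h f = (\<lambda>m\<in>monomials X. h (f m))"

text \<open>With \<open>h\<close> the evaluation at an index or the restriction to a set of indices, this gives the projections
  of \<open>A[[X]]\<close> for a direct sum \<open>A\<close>.\<close>

lemma map_series_hom:
  assumes "cring A" "cring B" "h \<in> ring_hom A B"
  shows "map_series X h \<in> ring_hom (power_series_ring A X) (power_series_ring B X)"
proof -
  interpret ring_hom_cring A B h
    using assms by (simp add: ring_hom_cring_def ring_hom_cring_axioms_def)
  show ?thesis
  proof (rule ring_hom_memI)
    fix f g
    assume f: "f \<in> carrier (power_series_ring A X)" and g: "g \<in> carrier (power_series_ring A X)"
    show "map_series X h (f \<otimes>\<^bsub>power_series_ring A X\<^esub> g) =
        map_series X h f \<otimes>\<^bsub>power_series_ring B X\<^esub> map_series X h g"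
      unfolding map_series_def power_series_ring_simps(2)
    proof (rule restrict_ext)
      fix m assume m: "m \<in> monomials X"
      have cl: "f u \<in> carrier A" "g v \<in> carrier A" "u \<in> monomials X" "v \<in> monomials X"
        if "u + v = m" for u v
        using that m f g by (auto simp: monomials_def intro!: R.power_series_coeff_closed)
      show "h ((\<lambda>m\<in>monomials X. \<Oplus>\<^bsub>A\<^esub>p\<in>splittings m. f (fst p) \<otimes>\<^bsub>A\<^esub> g (snd p)) m) =
          (\<Oplus>\<^bsub>B\<^esub>p\<in>splittings m. (\<lambda>m\<in>monomials X. h (f m)) (fst p) \<otimes>\<^bsub>B\<^esub>
            (\<lambda>m\<in>monomials X. h (g m)) (snd p))"
        using m cl by (auto simp: Pi_def intro!: S.finsum_cong')
    qed
  qed (auto simp: map_series_def power_series_ring_simps PiE_iff intro!: restrict_ext)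
qed

section \<open>Idempotent power series\<close>

context cring
begin

lemma idempotent_complement:
  assumes "e \<in> idempotents R"
  shows "\<one> \<ominus> e \<in> idempotents R"
proof -
  have e: "e \<in> carrier R" "e \<otimes> e = e"
    using assms by (auto simp: idempotents_def)
  have "(\<one> \<ominus> e) \<otimes> (\<one> \<ominus> e) = \<one> \<ominus> e \<ominus> (e \<ominus> e \<otimes> e)"
    using e(1) by algebra
  also have "\<dots> = \<one> \<ominus> e"
    unfolding e(2) using e(1) by algebra
  finally show ?thesis
    using e(1) by (simp add: idempotents_def)
qed

text \<open>The coefficients of \<open>e\<close> vanish by induction on the degree: in \<open>e m = (\<Sum> u + v = m. e u * e v)\<close>
  the summand with \<open>v\<close> empty contains the factor \<open>e {#} = 0\<close>, and in all others the degree of \<open>u\<close>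
  is smaller than that of \<open>m\<close>.\<close>

lemma idempotent_series_eq_zero:
  assumes e: "e \<in> idempotents (power_series_ring R X)" and e0: "e {#} = \<zero>"
  shows "e = \<zero>\<^bsub>power_series_ring R X\<^esub>"
proof -
  have ec: "e \<in> carrier (power_series_ring R X)"
    and ee: "e \<otimes>\<^bsub>power_series_ring R X\<^esub> e = e"
    using e by (auto simp: idempotents_def)
  have zero: "e m = \<zero>" if "m \<in> monomials X" for m
    using that
  proof (induction m rule: measure_induct_rule[of size])
    case (less m)
    have "e (fst p) \<otimes> e (snd p) = \<zero>" if p: "p \<in> splittings m" for p
    proof (cases "snd p = {#}")
      case True
      then show ?thesis
        using e0 power_series_coeff_closed[OF ec] splittings_monomials[OF p less.prems] by simp
    next
      case False
      then have "size (fst p) < size m"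
        using p by (auto simp: nonempty_has_size)
      then show ?thesis
        using less.IH power_series_coeff_closed[OF ec] splittings_monomials[OF p less.prems] by simp
    qed
    then have "(\<Oplus>p\<in>splittings m. e (fst p) \<otimes> e (snd p)) = \<zero>"
      by (intro add.finprod_one_eqI) auto
    then show ?case
      using less.prems fun_cong[OF ee, of m] by (simp add: power_series_ring_simps(2))
  qed
  interpret S: cring "power_series_ring R X"
    by (rule power_series_ring_cring)
  show ?thesis
    by (rule power_series_eqI[OF ec S.zero_closed]) (simp add: zero power_series_ring_simps(5))
qed

lemma power_series_constant_coeff_mult:
  fixes f g :: "'x multiset \<Rightarrow> 'a"
  assumes "f \<in> carrier (power_series_ring R X)" "g \<in> carrier (power_series_ring R X)"
  shows "(f \<otimes>\<^bsub>power_series_ring R X\<^esub> g) {#} = f {#} \<otimes> g {#}"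
proof -
  have "splittings ({#} :: 'x multiset) = {({#}, {#})}"
    by auto
  then show ?thesis
    using power_series_coeff_closed[OF assms(1) empty_in_monomials]
      power_series_coeff_closed[OF assms(2) empty_in_monomials]
    by (simp add: power_series_ring_simps(2) empty_in_monomials)
qed

text \<open>The constant coefficient of an idempotent series is an idempotent of \<open>R\<close>, so it is \<open>0\<close> or
  \<open>1\<close>. The previous argument applies to \<open>e\<close> in the first case and to \<open>1 - e\<close> in the second.\<close>

lemma power_series_no_nontrivial_idempotents:
  assumes "no_nontrivial_idempotents R"
  shows "no_nontrivial_idempotents (power_series_ring R X)"
proof -
  interpret S: cring "power_series_ring R X"
    by (rule power_series_ring_cring)
  have "e = \<zero>\<^bsub>power_series_ring R X\<^esub> \<or> e = \<one>\<^bsub>power_series_ring R X\<^esub>"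
    if e: "e \<in> idempotents (power_series_ring R X)" for e
  proof -
    have ec: "e \<in> carrier (power_series_ring R X)"
      and ee: "e \<otimes>\<^bsub>power_series_ring R X\<^esub> e = e"
      using e by (auto simp: idempotents_def)
    have "e {#} \<in> idempotents R"
      using power_series_constant_coeff_mult[OF ec ec] power_series_coeff_closed[OF ec empty_in_monomials]
      by (simp add: ee idempotents_def)
    then consider "e {#} = \<zero>" | "e {#} = \<one>"
      using assms by (auto simp: no_nontrivial_idempotents_def)
    then show ?thesis
    proof cases
      case 1
      then show ?thesis using idempotent_series_eq_zero[OF e] by simp
    next
      case 2
      let ?d = "\<one>\<^bsub>power_series_ring R X\<^esub> \<ominus>\<^bsub>power_series_ring R X\<^esub> e"
      have d: "?d \<in> carrier (power_series_ring R X)"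
        using ec by simp
      have "?d \<oplus>\<^bsub>power_series_ring R X\<^esub> e = \<one>\<^bsub>power_series_ring R X\<^esub>"
        using ec by algebra
      then have "(?d \<oplus>\<^bsub>power_series_ring R X\<^esub> e) {#} = \<one>\<^bsub>power_series_ring R X\<^esub> {#}"
        by (rule arg_cong)
      then have "?d {#} \<oplus> \<one> = \<one>"
        using 2 empty_in_monomials[of X] by (simp add: power_series_ring_simps(3,4))
      then have "?d {#} = \<zero>"
        using power_series_coeff_closed[OF d empty_in_monomials] by simp
      then have d0: "?d = \<zero>\<^bsub>power_series_ring R X\<^esub>"
        by (rule idempotent_series_eq_zero[OF S.idempotent_complement[OF e]])
      have "e = \<one>\<^bsub>power_series_ring R X\<^esub> \<ominus>\<^bsub>power_series_ring R X\<^esub> ?d"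
        using ec by algebra
      then show ?thesis
        unfolding d0 by (simp add: S.minus_eq)
    qed
  qed
  moreover have "{\<zero>\<^bsub>power_series_ring R X\<^esub>, \<one>\<^bsub>power_series_ring R X\<^esub>}
      \<subseteq> idempotents (power_series_ring R X)"
    by (auto simp: idempotents_def)
  ultimately show ?thesis
    unfolding no_nontrivial_idempotents_def by blast
qed

end

section \<open>Idempotent two-by-two matrices\<close>

definition idempotent_entries :: "('a, 'm) ring_scheme \<Rightarrow> 'a \<Rightarrow> 'a \<Rightarrow> 'a \<Rightarrow> 'a \<Rightarrow> bool" where
  "idempotent_entries R a b c d \<longleftrightarrow>
     a \<otimes>\<^bsub>R\<^esub> a \<oplus>\<^bsub>R\<^esub> b \<otimes>\<^bsub>R\<^esub> c = a \<and> a \<otimes>\<^bsub>R\<^esub> b \<oplus>\<^bsub>R\<^esub> b \<otimes>\<^bsub>R\<^esub> d = b \<and>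
     c \<otimes>\<^bsub>R\<^esub> a \<oplus>\<^bsub>R\<^esub> d \<otimes>\<^bsub>R\<^esub> c = c \<and> c \<otimes>\<^bsub>R\<^esub> b \<oplus>\<^bsub>R\<^esub> d \<otimes>\<^bsub>R\<^esub> d = d"

context cring
begin

lemma idempotent_entries_zero: "idempotent_entries R \<zero> \<zero> \<zero> \<zero>"
  and idempotent_entries_one: "idempotent_entries R \<one> \<zero> \<zero> \<one>"
  by (simp_all add: idempotent_entries_def)

lemma idempotent_entries_trace_one:
  assumes [simp]: "a \<in> carrier R" "b \<in> carrier R" "c \<in> carrier R"
    and eq: "a \<otimes> (\<one> \<ominus> a) = b \<otimes> c"
  shows "idempotent_entries R a b c (\<one> \<ominus> a)"
proof -
  have "a \<otimes> a \<oplus> a \<otimes> (\<one> \<ominus> a) = a" "a \<otimes> b \<oplus> b \<otimes> (\<one> \<ominus> a) = b"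
    "c \<otimes> a \<oplus> (\<one> \<ominus> a) \<otimes> c = c"
    "a \<otimes> (\<one> \<ominus> a) \<oplus> (\<one> \<ominus> a) \<otimes> (\<one> \<ominus> a) = \<one> \<ominus> a"
    using assms(1-3) by algebra+
  then show ?thesis
    by (simp add: idempotent_entries_def eq m_comm)
qed

text \<open>For \<open>M\<close> idempotent with determinant \<open>D\<close> and trace \<open>t\<close>, multiplicativity of the determinant
  makes \<open>D\<close> idempotent. Multiplying \<open>M * M = M\<close> by the adjugate of \<open>M\<close> gives \<open>D M = D I\<close>, which
  forces \<open>M = I\<close> if \<open>D = 1\<close>. If \<open>D = 0\<close>, then the Cayley-Hamilton identity \<open>M * M = t M - D I\<close>
  reads \<open>t M = M\<close>; taking traces, \<open>t\<close> is idempotent too. For \<open>t = 0\<close> this yields \<open>M = 0\<close>, and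
  for \<open>t = 1\<close> the conditions left are \<open>d = 1 - a\<close> and \<open>a d = b c\<close>. If \<open>1 = 0\<close>, the cases overlap.\<close>

lemma idempotent_entries_cases:
  assumes R: "no_nontrivial_idempotents R"
    and cl: "a \<in> carrier R" "b \<in> carrier R" "c \<in> carrier R" "d \<in> carrier R"
    and idem: "idempotent_entries R a b c d"
  obtains (one) "a = \<one>" "b = \<zero>" "c = \<zero>" "d = \<one>"
    | (zero) "a = \<zero>" "b = \<zero>" "c = \<zero>" "d = \<zero>"
    | (trace_one) "d = \<one> \<ominus> a" "a \<otimes> (\<one> \<ominus> a) = b \<otimes> c"
proof -
  note [simp] = cl
  have trivial: "e = \<zero> \<or> e = \<one>" if "e \<in> carrier R" "e \<otimes> e = e" for e
    using R that by (auto simp: no_nontrivial_idempotents_def idempotents_def)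
  have eqs: "a \<otimes> a \<oplus> b \<otimes> c = a" "a \<otimes> b \<oplus> b \<otimes> d = b"
      "c \<otimes> a \<oplus> d \<otimes> c = c" "c \<otimes> b \<oplus> d \<otimes> d = d"
    using idem by (auto simp: idempotent_entries_def)
  define D where "D = a \<otimes> d \<ominus> b \<otimes> c"
  define t where "t = a \<oplus> d"
  have Dc [simp]: "D \<in> carrier R" and tc [simp]: "t \<in> carrier R"
    by (simp_all add: D_def t_def)
  \<comment> \<open>The right-hand side is the determinant of \<open>M * M\<close>.\<close>
  have "D \<otimes> D = (a \<otimes> a \<oplus> b \<otimes> c) \<otimes> (c \<otimes> b \<oplus> d \<otimes> d) \<ominus>
      (a \<otimes> b \<oplus> b \<otimes> d) \<otimes> (c \<otimes> a \<oplus> d \<otimes> c)"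
    unfolding D_def using cl by algebra
  then have "D \<otimes> D = D"
    unfolding eqs D_def .
  then consider "D = \<one>" | "D = \<zero>"
    using trivial[OF Dc] by auto
  then show thesis
  proof cases
    case 1
    \<comment> \<open>The four entries of the adjugate times \<open>M * M\<close>, and then of the adjugate times \<open>M\<close>.\<close>
    have "D \<otimes> a = d \<otimes> (a \<otimes> a \<oplus> b \<otimes> c) \<ominus> b \<otimes> (c \<otimes> a \<oplus> d \<otimes> c)"
      "D \<otimes> b = d \<otimes> (a \<otimes> b \<oplus> b \<otimes> d) \<ominus> b \<otimes> (c \<otimes> b \<oplus> d \<otimes> d)"
      "D \<otimes> c = a \<otimes> (c \<otimes> a \<oplus> d \<otimes> c) \<ominus> c \<otimes> (a \<otimes> a \<oplus> b \<otimes> c)"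
      "D \<otimes> d = a \<otimes> (c \<otimes> b \<oplus> d \<otimes> d) \<ominus> c \<otimes> (a \<otimes> b \<oplus> b \<otimes> d)"
      unfolding D_def using cl by algebra+
    moreover have "d \<otimes> a \<ominus> b \<otimes> c = D" "d \<otimes> b \<ominus> b \<otimes> d = \<zero>"
      "a \<otimes> c \<ominus> c \<otimes> a = \<zero>" "a \<otimes> d \<ominus> c \<otimes> b = D"
      unfolding D_def using cl by algebra+
    ultimately have "D \<otimes> a = D" "D \<otimes> b = \<zero>" "D \<otimes> c = \<zero>" "D \<otimes> d = D"
      unfolding eqs by simp_all
    then show thesis
      using 1 one by simp
  next
    case 2
    \<comment> \<open>The Cayley-Hamilton identity, entry by entry.\<close>
    have "t \<otimes> a = a \<otimes> a \<oplus> b \<otimes> c \<oplus> D" "t \<otimes> b = a \<otimes> b \<oplus> b \<otimes> d"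
      "t \<otimes> c = c \<otimes> a \<oplus> d \<otimes> c" "t \<otimes> d = c \<otimes> b \<oplus> d \<otimes> d \<oplus> D"
      unfolding D_def t_def using cl by algebra+
    then have ta: "t \<otimes> a = a" and tb: "t \<otimes> b = b" and tc': "t \<otimes> c = c" and td: "t \<otimes> d = d"
      unfolding eqs 2 by simp_all
    have "t \<otimes> t = t \<otimes> a \<oplus> t \<otimes> d"
      unfolding t_def using cl by algebra
    also have "\<dots> = t"
      by (simp only: ta td) (simp only: t_def)
    finally consider "t = \<zero>" | "t = \<one>"
      using trivial[OF tc] by auto
    then show thesis
    proof cases
      case 1
      then have "x = \<zero>" if "t \<otimes> x = x" "x \<in> carrier R" for x
        using that by simp
      then show thesis
        using zero ta tb tc' td cl by blast
    next
      case t1: 2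
      have "d = t \<ominus> a"
        unfolding t_def using cl by algebra
      then have d: "d = \<one> \<ominus> a"
        by (simp add: t1)
      moreover have "a \<otimes> d = D \<oplus> b \<otimes> c"
        unfolding D_def using cl by algebra
      then have "a \<otimes> d = b \<otimes> c"
        by (simp add: 2)
      ultimately show thesis
        using trace_one by simp
    qed
  qed
qed

end

lemma (in ring_hom_cring) hom_idempotent_entries:
  assumes "a \<in> carrier R" "b \<in> carrier R" "c \<in> carrier R" "d \<in> carrier R"
    and "idempotent_entries R a b c d"
  shows "idempotent_entries S (h a) (h b) (h c) (h d)"
  using assms unfolding idempotent_entries_def by (metis hom_add hom_mult R.m_closed)

lemma (in cring) idempotents_matrix_ring_2_iff:
  "M \<in> idempotents (matrix_ring 2 R) \<longleftrightarrow>
    M \<in> carrier_mat 2 2 \<and> (\<forall>j<2. \<forall>k<2. M $$ (j, k) \<in> carrier R) \<and>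
    idempotent_entries R (M $$ (0, 0)) (M $$ (0, 1)) (M $$ (1, 0)) (M $$ (1, 1))"
proof -
  have less_2: "{..<2} = {0, 1 :: nat}" "\<And>i. i < 2 \<longleftrightarrow> i = 0 \<or> i = (1 :: nat)"
    by auto
  have entries: "elements_mat M \<subseteq> carrier R \<longleftrightarrow> (\<forall>j<2. \<forall>k<2. M $$ (j, k) \<in> carrier R)"
    if "M \<in> carrier_mat 2 2"
  proof -
    have "dim_row M = 2" "dim_col M = 2"
      using that by auto
    then have "elements_mat M = (\<Union>j<2. \<Union>k<2. {M $$ (j, k)})"
      by (auto simp: elements_mat_def) (metis lessThan_iff)
    then show ?thesis by auto
  qed
  show ?thesis
  proof (cases "M \<in> carrier_mat 2 2 \<and> (\<forall>j<2. \<forall>k<2. M $$ (j, k) \<in> carrier R)")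
    case True
    then have "M \<in> carrier_mat 2 2"
      and cl: "M $$ (0, 0) \<in> carrier R" "M $$ (0, 1) \<in> carrier R"
        "M $$ (1, 0) \<in> carrier R" "M $$ (1, 1) \<in> carrier R"
      by auto
    have "mat 2 2 (\<lambda>(j, k). \<Oplus>l\<in>{..<2}. M $$ (j, l) \<otimes> M $$ (l, k)) = M \<longleftrightarrow>
        (\<forall>j<2. \<forall>k<2. (\<Oplus>l\<in>{..<2}. M $$ (j, l) \<otimes> M $$ (l, k)) = M $$ (j, k))"
      using \<open>M \<in> carrier_mat 2 2\<close> by (auto simp: mat_eq_iff)
    also have "\<dots> \<longleftrightarrow>
        idempotent_entries R (M $$ (0, 0)) (M $$ (0, 1)) (M $$ (1, 0)) (M $$ (1, 1))"
      unfolding less_2 idempotent_entries_def using cl by (auto simp: finsum_insert)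
    finally show ?thesis
      using True entries by (simp add: idempotents_def matrix_ring_def)
  next
    case False
    then show ?thesis
      using entries by (auto simp: idempotents_def matrix_ring_def)
  qed
qed

section \<open>Reduction to the summands\<close>

abbreviation component :: "'x set \<Rightarrow> 'i \<Rightarrow> ('x multiset \<Rightarrow> 'i \<Rightarrow> 'a) \<Rightarrow> ('x multiset \<Rightarrow> 'a)" where
  "component X i \<equiv> map_series X (\<lambda>x. x i)"

lemma direct_sum_series_cring:
  assumes "\<And>i. i \<in> I \<Longrightarrow> cring (A i)"
  shows "cring (power_series_ring (direct_sum_ring I A) X)"
  using direct_sum_ring_cring[OF assms] by (rule cring.power_series_ring_cring)

lemma component_hom_cring:
  assumes "\<And>i. i \<in> I \<Longrightarrow> cring (A i)" "i \<in> I"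
  shows "ring_hom_cring (power_series_ring (direct_sum_ring I A) X) (power_series_ring (A i) X)
    (component X i)"
  using assms by (intro ring_hom_cring.intro ring_hom_cring_axioms.intro map_series_hom
      direct_sum_ring_component_hom direct_sum_ring_cring cring.power_series_ring_cring)

lemma direct_sum_series_eqI:
  assumes f: "f \<in> carrier (power_series_ring (direct_sum_ring I A) X)"
    and g: "g \<in> carrier (power_series_ring (direct_sum_ring I A) X)"
    and eq: "\<And>i. i \<in> I \<Longrightarrow> component X i f = component X i g"
  shows "f = g"
proof (rule power_series_eqI[OF f g])
  fix m assume m: "m \<in> monomials X"
  have "f m i = g m i" if "i \<in> I" for i
    using fun_cong[OF eq[OF that], of m] m by (simp add: map_series_def)
  moreover have "f m \<in> (\<Pi>\<^sub>E i\<in>I. carrier (A i))" "g m \<in> (\<Pi>\<^sub>E i\<in>I. carrier (A i))"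
    using f g m by (auto simp: power_series_ring_simps direct_sum_ring_simps PiE_mem)
  ultimately show "f m = g m"
    by (intro PiE_ext)
qed

text \<open>The projections are ring homomorphisms and together they are injective, so a polynomial identity
  between series over the direct sum holds exactly if it holds in every summand.\<close>

lemma idempotent_entries_componentwise:
  assumes A: "\<And>i. i \<in> I \<Longrightarrow> cring (A i)"
    and cl: "a \<in> carrier (power_series_ring (direct_sum_ring I A) X)"
      "b \<in> carrier (power_series_ring (direct_sum_ring I A) X)"
      "c \<in> carrier (power_series_ring (direct_sum_ring I A) X)"
      "d \<in> carrier (power_series_ring (direct_sum_ring I A) X)"
  shows "idempotent_entries (power_series_ring (direct_sum_ring I A) X) a b c d \<longleftrightarrow>
    (\<forall>i\<in>I. idempotent_entries (power_series_ring (A i) X)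
      (component X i a) (component X i b) (component X i c) (component X i d))"
proof
  assume "idempotent_entries (power_series_ring (direct_sum_ring I A) X) a b c d"
  then show "\<forall>i\<in>I. idempotent_entries (power_series_ring (A i) X)
      (component X i a) (component X i b) (component X i c) (component X i d)"
    using ring_hom_cring.hom_idempotent_entries[OF component_hom_cring[OF A] cl] by blast
next
  assume *: "\<forall>i\<in>I. idempotent_entries (power_series_ring (A i) X)
      (component X i a) (component X i b) (component X i c) (component X i d)"
  interpret cring "power_series_ring (direct_sum_ring I A) X"
    by (rule direct_sum_series_cring) (rule A)
  have "component X i (u \<otimes>\<^bsub>power_series_ring (direct_sum_ring I A) X\<^esub> v
        \<oplus>\<^bsub>power_series_ring (direct_sum_ring I A) X\<^esub>
        w \<otimes>\<^bsub>power_series_ring (direct_sum_ring I A) X\<^esub> z) =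
      component X i u \<otimes>\<^bsub>power_series_ring (A i) X\<^esub> component X i v
        \<oplus>\<^bsub>power_series_ring (A i) X\<^esub>
        component X i w \<otimes>\<^bsub>power_series_ring (A i) X\<^esub> component X i z"
    if "i \<in> I" "u \<in> carrier (power_series_ring (direct_sum_ring I A) X)"
      "v \<in> carrier (power_series_ring (direct_sum_ring I A) X)"
      "w \<in> carrier (power_series_ring (direct_sum_ring I A) X)"
      "z \<in> carrier (power_series_ring (direct_sum_ring I A) X)" for i u v w z
  proof -
    interpret ring_hom_cring "power_series_ring (direct_sum_ring I A) X"
      "power_series_ring (A i) X" "component X i"
      using A that by (intro component_hom_cring)
    show ?thesis using that by simp
  qed
  with * cl show "idempotent_entries (power_series_ring (direct_sum_ring I A) X) a b c d"
    unfolding idempotent_entries_def by (intro conjI direct_sum_series_eqI) auto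
qed

lemma triple_series_closed:
  assumes "f \<in> carrier (power_series_ring (direct_sum_ring P A) X)"
    and "g \<in> carrier (power_series_ring (direct_sum_ring Q A) X)"
    and "h \<in> carrier (power_series_ring (direct_sum_ring R A) X)"
  shows "triple_series X P Q R f g h \<in>
    carrier (power_series_ring (direct_sum_ring (P \<union> Q \<union> R) A) X)"
proof -
  have "f m i \<in> carrier (A i)" if "m \<in> monomials X" "i \<in> P" for m i
    using assms(1) that by (auto simp: power_series_ring_simps direct_sum_ring_simps)
  moreover have "g m i \<in> carrier (A i)" if "m \<in> monomials X" "i \<in> Q" for m i
    using assms(2) that by (auto simp: power_series_ring_simps direct_sum_ring_simps)
  moreover have "h m i \<in> carrier (A i)" if "m \<in> monomials X" "i \<in> R" for m i
    using assms(3) that by (auto simp: power_series_ring_simps direct_sum_ring_simps)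
  ultimately show ?thesis
    by (auto simp: power_series_ring_simps direct_sum_ring_simps triple_series_def triple_elem_def)
qed

lemma component_triple_series:
  assumes "i \<in> P \<union> Q \<union> R"
  shows "component X i (triple_series X P Q R f g h) =
    (if i \<in> P then component X i f else if i \<in> Q then component X i g else component X i h)"
  using assms by (auto simp: map_series_def triple_series_def triple_elem_def)

section \<open>The block idempotents\<close>

text \<open>The matrix \<open>(a\<^sub>P(X), I\<^sub>2, 0\<^sub>2)\<close> given by \<open>\<alpha>\<close>, \<open>\<beta>\<close>, \<open>\<gamma>\<close>.\<close>

definition block_idempotent ::
  "('i \<Rightarrow> ('a, 'm) ring_scheme) \<Rightarrow> 'x set \<Rightarrow> 'i set \<Rightarrow> 'i set \<Rightarrow> 'i set \<Rightarrow>
    ('x multiset \<Rightarrow> 'i \<Rightarrow> 'a) \<Rightarrow> ('x multiset \<Rightarrow> 'i \<Rightarrow> 'a) \<Rightarrow> ('x multiset \<Rightarrow> 'i \<Rightarrow> 'a) \<Rightarrow>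
    ('x multiset \<Rightarrow> 'i \<Rightarrow> 'a) mat" where
  "block_idempotent A X P Q R \<alpha> \<beta> \<gamma> =
    (let AP = power_series_ring (direct_sum_ring P A) X;
         AQ = power_series_ring (direct_sum_ring Q A) X;
         AR = power_series_ring (direct_sum_ring R A) X
     in triple_matrix X P Q R
          (mat_of_rows_list 2 [[\<alpha>, \<beta>], [\<gamma>, \<one>\<^bsub>AP\<^esub> \<ominus>\<^bsub>AP\<^esub> \<alpha>]])
          \<one>\<^bsub>matrix_ring 2 AQ\<^esub> \<zero>\<^bsub>matrix_ring 2 AR\<^esub>)"

lemma block_idempotent_entries:
  fixes A :: "'i \<Rightarrow> ('a, 'm) ring_scheme" and X :: "'x set" and P Q R :: "'i set"
  defines "AP \<equiv> power_series_ring (direct_sum_ring P A) X"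
    and "AQ \<equiv> power_series_ring (direct_sum_ring Q A) X"
    and "AR \<equiv> power_series_ring (direct_sum_ring R A) X"
  shows "block_idempotent A X P Q R \<alpha> \<beta> \<gamma> \<in> carrier_mat 2 2"
    and "block_idempotent A X P Q R \<alpha> \<beta> \<gamma> $$ (0, 0) = triple_series X P Q R \<alpha> \<one>\<^bsub>AQ\<^esub> \<zero>\<^bsub>AR\<^esub>"
    and "block_idempotent A X P Q R \<alpha> \<beta> \<gamma> $$ (0, 1) = triple_series X P Q R \<beta> \<zero>\<^bsub>AQ\<^esub> \<zero>\<^bsub>AR\<^esub>"
    and "block_idempotent A X P Q R \<alpha> \<beta> \<gamma> $$ (1, 0) = triple_series X P Q R \<gamma> \<zero>\<^bsub>AQ\<^esub> \<zero>\<^bsub>AR\<^esub>"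
    and "block_idempotent A X P Q R \<alpha> \<beta> \<gamma> $$ (1, 1) =
      triple_series X P Q R (\<one>\<^bsub>AP\<^esub> \<ominus>\<^bsub>AP\<^esub> \<alpha>) \<one>\<^bsub>AQ\<^esub> \<zero>\<^bsub>AR\<^esub>"
  by (simp_all add: block_idempotent_def triple_matrix_def matrix_ring_def mat_of_rows_list_def
      Let_def AP_def AQ_def AR_def)

lemma component_block_idempotent:
  fixes A :: "'i \<Rightarrow> ('a, 'm) ring_scheme" and X :: "'x set" and P Q R :: "'i set"
    and \<alpha> \<beta> \<gamma> :: "'x multiset \<Rightarrow> 'i \<Rightarrow> 'a"
  assumes A: "\<forall>i\<in>P \<union> Q \<union> R. cring (A i)" and i: "i \<in> P \<union> Q \<union> R"
    and \<alpha>: "\<alpha> \<in> carrier (power_series_ring (direct_sum_ring P A) X)"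
  defines "B \<equiv> power_series_ring (A i) X"
    and "e \<equiv> \<lambda>j k. component X i (block_idempotent A X P Q R \<alpha> \<beta> \<gamma> $$ (j, k))"
  shows "i \<in> P \<Longrightarrow> e 0 0 = component X i \<alpha> \<and> e 0 1 = component X i \<beta> \<and>
      e 1 0 = component X i \<gamma> \<and> e 1 1 = \<one>\<^bsub>B\<^esub> \<ominus>\<^bsub>B\<^esub> component X i \<alpha>"
    and "i \<in> Q - P \<Longrightarrow> e 0 0 = \<one>\<^bsub>B\<^esub> \<and> e 0 1 = \<zero>\<^bsub>B\<^esub> \<and> e 1 0 = \<zero>\<^bsub>B\<^esub> \<and> e 1 1 = \<one>\<^bsub>B\<^esub>"
    and "i \<in> R - P - Q \<Longrightarrow> e 0 0 = \<zero>\<^bsub>B\<^esub> \<and> e 0 1 = \<zero>\<^bsub>B\<^esub> \<and> e 1 0 = \<zero>\<^bsub>B\<^esub> \<and> e 1 1 = \<zero>\<^bsub>B\<^esub>"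
proof -
  note comp = component_triple_series[OF i]
  show "e 0 0 = component X i \<alpha> \<and> e 0 1 = component X i \<beta> \<and>
      e 1 0 = component X i \<gamma> \<and> e 1 1 = \<one>\<^bsub>B\<^esub> \<ominus>\<^bsub>B\<^esub> component X i \<alpha>" if "i \<in> P"
  proof -
    interpret ring_hom_cring "power_series_ring (direct_sum_ring P A) X" B "component X i"
      unfolding B_def using A that by (intro component_hom_cring) auto
    show ?thesis
      using that \<alpha> by (simp add: e_def block_idempotent_entries comp R.minus_eq S.minus_eq
          del: One_nat_def)
  qed
  show "e 0 0 = \<one>\<^bsub>B\<^esub> \<and> e 0 1 = \<zero>\<^bsub>B\<^esub> \<and> e 1 0 = \<zero>\<^bsub>B\<^esub> \<and> e 1 1 = \<one>\<^bsub>B\<^esub>" if "i \<in> Q - P"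
  proof -
    interpret ring_hom_cring "power_series_ring (direct_sum_ring Q A) X" B "component X i"
      unfolding B_def using A that by (intro component_hom_cring) auto
    show ?thesis
      using that by (simp add: e_def block_idempotent_entries comp del: One_nat_def)
  qed
  show "e 0 0 = \<zero>\<^bsub>B\<^esub> \<and> e 0 1 = \<zero>\<^bsub>B\<^esub> \<and> e 1 0 = \<zero>\<^bsub>B\<^esub> \<and> e 1 1 = \<zero>\<^bsub>B\<^esub>" if "i \<in> R - P - Q"
  proof -
    interpret ring_hom_cring "power_series_ring (direct_sum_ring R A) X" B "component X i"
      unfolding B_def using A that by (intro component_hom_cring) auto
    show ?thesis
      using that by (simp add: e_def block_idempotent_entries comp del: One_nat_def)
  qed
qed

lemma block_idempotent_closed:
  assumes A: "\<forall>i\<in>P \<union> Q \<union> R. cring (A i)"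
    and cl: "\<alpha> \<in> carrier (power_series_ring (direct_sum_ring P A) X)"
      "\<beta> \<in> carrier (power_series_ring (direct_sum_ring P A) X)"
      "\<gamma> \<in> carrier (power_series_ring (direct_sum_ring P A) X)"
    and jk: "j < 2" "k < 2"
  shows "block_idempotent A X P Q R \<alpha> \<beta> \<gamma> $$ (j, k) \<in>
    carrier (power_series_ring (direct_sum_ring (P \<union> Q \<union> R) A) X)"
proof -
  interpret P: cring "power_series_ring (direct_sum_ring P A) X"
    by (rule direct_sum_series_cring) (simp add: A)
  interpret Q: cring "power_series_ring (direct_sum_ring Q A) X"
    by (rule direct_sum_series_cring) (simp add: A)
  interpret R: cring "power_series_ring (direct_sum_ring R A) X"
    by (rule direct_sum_series_cring) (simp add: A)
  consider "j = 0" "k = 0" | "j = 0" "k = 1" | "j = 1" "k = 0" | "j = 1" "k = 1"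
    using jk by linarith
  then show ?thesis
    by cases (simp_all only: block_idempotent_entries, (intro triple_series_closed cl P.minus_closed
      P.one_closed Q.one_closed Q.zero_closed R.zero_closed)+)
qed

lemma block_idempotent_in_idempotents:
  fixes A :: "'i \<Rightarrow> ('a, 'm) ring_scheme" and X :: "'x set"
  defines "S J \<equiv> power_series_ring (direct_sum_ring J A) X"
  assumes A: "\<forall>i\<in>P \<union> Q \<union> R. cring (A i)"
    and cl: "\<alpha> \<in> carrier (S P)" "\<beta> \<in> carrier (S P)" "\<gamma> \<in> carrier (S P)"
    and eq: "\<alpha> \<otimes>\<^bsub>S P\<^esub> (\<one>\<^bsub>S P\<^esub> \<ominus>\<^bsub>S P\<^esub> \<alpha>) = \<beta> \<otimes>\<^bsub>S P\<^esub> \<gamma>"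
  shows "block_idempotent A X P Q R \<alpha> \<beta> \<gamma> \<in>
    idempotents (matrix_ring 2 (S (P \<union> Q \<union> R)))"
proof -
  let ?a = "block_idempotent A X P Q R \<alpha> \<beta> \<gamma>"
  interpret W: cring "S (P \<union> Q \<union> R)"
    unfolding S_def by (rule direct_sum_series_cring) (simp add: A)
  interpret P: cring "S P"
    unfolding S_def by (rule direct_sum_series_cring) (simp add: A)
  have closed: "?a $$ (j, k) \<in> carrier (S (P \<union> Q \<union> R))" if "j < 2" "k < 2" for j k
    unfolding S_def
    by (rule block_idempotent_closed[OF A cl[unfolded S_def] that])
  have "idempotent_entries (power_series_ring (A i) X)
      (component X i (?a $$ (0, 0))) (component X i (?a $$ (0, 1)))
      (component X i (?a $$ (1, 0))) (component X i (?a $$ (1, 1)))"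
    if i: "i \<in> P \<union> Q \<union> R" for i
  proof -
    interpret B: cring "power_series_ring (A i) X"
      using bspec[OF A i] by (rule cring.power_series_ring_cring)
    note comp = component_block_idempotent[OF A i cl(1)[unfolded S_def]]
    consider "i \<in> P" | "i \<in> Q - P" | "i \<in> R - P - Q"
      using i by blast
    then show ?thesis
    proof cases
      case 1
      interpret ring_hom_cring "S P" "power_series_ring (A i) X" "component X i"
        unfolding S_def using A 1 by (intro component_hom_cring) auto
      have "idempotent_entries (S P) \<alpha> \<beta> \<gamma> (\<one>\<^bsub>S P\<^esub> \<ominus>\<^bsub>S P\<^esub> \<alpha>)"
        using cl eq by (rule P.idempotent_entries_trace_one)
      from hom_idempotent_entries[OF _ _ _ _ this] cl show ?thesis
        using comp(1)[OF 1] by (simp add: P.minus_eq B.minus_eq)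
    next
      case 2
      then show ?thesis using comp(2) B.idempotent_entries_one by simp
    next
      case 3
      then show ?thesis using comp(3) B.idempotent_entries_zero by simp
    qed
  qed
  then have "idempotent_entries (S (P \<union> Q \<union> R))
      (?a $$ (0, 0)) (?a $$ (0, 1)) (?a $$ (1, 0)) (?a $$ (1, 1))"
    unfolding S_def
    using closed[unfolded S_def] by (subst idempotent_entries_componentwise) (auto simp: A)
  then show ?thesis
    unfolding W.idempotents_matrix_ring_2_iff
    by (intro conjI allI impI block_idempotent_entries(1) closed)
qed

section \<open>Splitting the index set\<close>

lemma restrict_hom:
  assumes "J \<subseteq> I"
  shows "(\<lambda>x. restrict x J) \<in> ring_hom (direct_sum_ring I A) (direct_sum_ring J A)"
  using assms by (intro ring_hom_memI) (auto simp: direct_sum_ring_simps fun_eq_iff PiE_iff)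

lemma component_restrict:
  assumes "i \<in> J"
  shows "component X i (map_series X (\<lambda>x. restrict x J) f) = component X i f"
  using assms by (auto simp: map_series_def)

text \<open>Each index goes into \<open>Q\<close> if the matrix projects to \<open>I\<^sub>2\<close> there, into \<open>R\<close> if it projects to
  \<open>0\<^sub>2\<close>, and into \<open>P\<close> otherwise. On \<open>P\<close> only the trace-one alternative of
  \<open>idempotent_entries_cases\<close> remains, so the restrictions of the first three entries to \<open>P\<close> can be
  taken as \<open>\<alpha>\<close>, \<open>\<beta>\<close>, \<open>\<gamma>\<close>.\<close>

lemma idempotent_eq_block_idempotent:
  fixes A :: "'i \<Rightarrow> ('a, 'm) ring_scheme" and X :: "'x set"
  defines "S J \<equiv> power_series_ring (direct_sum_ring J A) X"
  assumes A: "\<And>i. i \<in> I \<Longrightarrow> cring (A i)"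
    and triv: "\<And>i. i \<in> I \<Longrightarrow> no_nontrivial_idempotents (A i)"
    and a: "a \<in> idempotents (matrix_ring 2 (S I))"
  shows "\<exists>P Q R \<alpha> \<beta> \<gamma>. P \<union> Q \<union> R = I \<and> P \<inter> Q = {} \<and> P \<inter> R = {} \<and> Q \<inter> R = {} \<and>
    \<alpha> \<in> carrier (S P) \<and> \<beta> \<in> carrier (S P) \<and> \<gamma> \<in> carrier (S P) \<and>
    \<alpha> \<otimes>\<^bsub>S P\<^esub> (\<one>\<^bsub>S P\<^esub> \<ominus>\<^bsub>S P\<^esub> \<alpha>) = \<beta> \<otimes>\<^bsub>S P\<^esub> \<gamma> \<and>
    a = block_idempotent A X P Q R \<alpha> \<beta> \<gamma>"
proof -
  interpret W: cring "S I"
    unfolding S_def by (rule direct_sum_series_cring) (rule A)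
  have am: "a \<in> carrier_mat 2 2" and ac: "\<And>j k. j < 2 \<Longrightarrow> k < 2 \<Longrightarrow> a $$ (j, k) \<in> carrier (S I)"
    and ai: "idempotent_entries (S I) (a $$ (0, 0)) (a $$ (0, 1)) (a $$ (1, 0)) (a $$ (1, 1))"
    using a unfolding W.idempotents_matrix_ring_2_iff by auto
  define e where "e i j k = component X i (a $$ (j, k))" for i j k
  define B where "B i = power_series_ring (A i) X" for i
  define Q where "Q = {i \<in> I. e i 0 0 = \<one>\<^bsub>B i\<^esub> \<and> e i 0 1 = \<zero>\<^bsub>B i\<^esub> \<and>
    e i 1 0 = \<zero>\<^bsub>B i\<^esub> \<and> e i 1 1 = \<one>\<^bsub>B i\<^esub>}"
  \<comment> \<open>Over a zero ring \<open>I\<^sub>2 = 0\<^sub>2\<close>, so \<open>Q\<close> has to be removed to keep the parts disjoint.\<close>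
  define R where "R = {i \<in> I - Q. e i 0 0 = \<zero>\<^bsub>B i\<^esub> \<and> e i 0 1 = \<zero>\<^bsub>B i\<^esub> \<and>
    e i 1 0 = \<zero>\<^bsub>B i\<^esub> \<and> e i 1 1 = \<zero>\<^bsub>B i\<^esub>}"
  define P where "P = I - Q - R"
  have part: "P \<union> Q \<union> R = I" "P \<inter> Q = {}" "P \<inter> R = {}" "Q \<inter> R = {}"
    by (auto simp: P_def Q_def R_def)
  have hom: "ring_hom_cring (S J) (B i) (component X i)" if "J \<subseteq> I" "i \<in> J" for i J
    unfolding S_def B_def using that A by (intro component_hom_cring) auto
  have trace_one: "e i 1 1 = \<one>\<^bsub>B i\<^esub> \<ominus>\<^bsub>B i\<^esub> e i 0 0 \<and>
      e i 0 0 \<otimes>\<^bsub>B i\<^esub> (\<one>\<^bsub>B i\<^esub> \<ominus>\<^bsub>B i\<^esub> e i 0 0) = e i 0 1 \<otimes>\<^bsub>B i\<^esub> e i 1 0"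
    if "i \<in> P" for i
  proof -
    have i: "i \<in> I" "i \<notin> Q" "i \<notin> R"
      using that by (auto simp: P_def)
    interpret ring_hom_cring "S I" "B i" "component X i"
      using hom[of I i] i by simp
    have "no_nontrivial_idempotents (B i)"
      unfolding B_def using A[OF i(1)] triv[OF i(1)]
      by (rule cring.power_series_no_nontrivial_idempotents)
    moreover have "idempotent_entries (B i) (e i 0 0) (e i 0 1) (e i 1 0) (e i 1 1)"
      unfolding e_def using ai by (intro hom_idempotent_entries ac) auto
    moreover have "e i j k \<in> carrier (B i)" if "j < 2" "k < 2" for j k
      unfolding e_def using ac[OF that] by simp
    ultimately show ?thesis
      using i by (elim S.idempotent_entries_cases) (auto simp: Q_def R_def)
  qed
  define r where "r = map_series X (\<lambda>x :: 'i \<Rightarrow> 'a. restrict x P)"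
  define \<alpha> \<beta> \<gamma> where "\<alpha> = r (a $$ (0, 0))" and "\<beta> = r (a $$ (0, 1))" and "\<gamma> = r (a $$ (1, 0))"
  have P: "P \<subseteq> I"
    by (auto simp: P_def)
  have "r \<in> ring_hom (S I) (S P)"
    unfolding r_def S_def using P A
    by (intro map_series_hom direct_sum_ring_cring restrict_hom) auto
  then have cl: "\<alpha> \<in> carrier (S P)" "\<beta> \<in> carrier (S P)" "\<gamma> \<in> carrier (S P)"
    unfolding \<alpha>_def \<beta>_def \<gamma>_def by (simp_all add: ring_hom_closed ac)
  have comp: "component X i \<alpha> = e i 0 0" "component X i \<beta> = e i 0 1" "component X i \<gamma> = e i 1 0"
    if "i \<in> P" for i
    using that by (simp_all add: \<alpha>_def \<beta>_def \<gamma>_def r_def e_def component_restrict)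
  have eq: "\<alpha> \<otimes>\<^bsub>S P\<^esub> (\<one>\<^bsub>S P\<^esub> \<ominus>\<^bsub>S P\<^esub> \<alpha>) = \<beta> \<otimes>\<^bsub>S P\<^esub> \<gamma>"
  proof -
    interpret P: cring "S P"
      unfolding S_def by (rule direct_sum_series_cring) (use A P in blast)
    have "component X i (\<alpha> \<otimes>\<^bsub>S P\<^esub> (\<one>\<^bsub>S P\<^esub> \<ominus>\<^bsub>S P\<^esub> \<alpha>)) = component X i (\<beta> \<otimes>\<^bsub>S P\<^esub> \<gamma>)"
      if i: "i \<in> P" for i
    proof -
      interpret ring_hom_cring "S P" "B i" "component X i"
        using hom P i by blast
      show ?thesis
        using cl trace_one[OF i] comp[OF i] by (simp add: P.minus_eq S.minus_eq)
    qed
    then show ?thesis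
      using cl by (intro direct_sum_series_eqI[of _ P A X, folded S_def]) auto
  qed
  let ?b = "block_idempotent A X P Q R \<alpha> \<beta> \<gamma>"
  have A': "\<forall>i\<in>P \<union> Q \<union> R. cring (A i)"
    using A part by blast
  have "a $$ (j, k) = ?b $$ (j, k)" if jk: "j < 2" "k < 2" for j k
  proof (rule direct_sum_series_eqI)
    show "a $$ (j, k) \<in> carrier (power_series_ring (direct_sum_ring I A) X)"
      using ac[OF jk] by (simp add: S_def)
    show "?b $$ (j, k) \<in> carrier (power_series_ring (direct_sum_ring I A) X)"
      using block_idempotent_closed[OF A' cl[unfolded S_def] jk] part by simp
    fix i assume i: "i \<in> I"
    then have i': "i \<in> P \<union> Q \<union> R"
      using part by simp
    have "(j = 0 \<or> j = 1) \<and> (k = 0 \<or> k = 1)"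
      using jk by auto
    moreover consider "i \<in> P" | "i \<in> Q - P" | "i \<in> R - P - Q"
      using i' by blast
    then have "e i 0 0 = component X i (?b $$ (0, 0)) \<and> e i 0 1 = component X i (?b $$ (0, 1)) \<and>
      e i 1 0 = component X i (?b $$ (1, 0)) \<and> e i 1 1 = component X i (?b $$ (1, 1))"
    proof cases
      case 1
      then show ?thesis
        using component_block_idempotent(1)[OF A' i' cl(1)[unfolded S_def]] comp trace_one
        by (simp add: B_def)
    next
      case 2
      then show ?thesis
        using component_block_idempotent(2)[OF A' i' cl(1)[unfolded S_def]]
        by (simp add: Q_def B_def)
    next
      case 3
      then show ?thesis
        using component_block_idempotent(3)[OF A' i' cl(1)[unfolded S_def]]
        by (simp add: R_def B_def)
    qed
    ultimately show "component X i (a $$ (j, k)) = component X i (?b $$ (j, k))"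
      by (auto simp: e_def)
  qed
  then have "a = ?b"
    using am block_idempotent_entries(1)[of A X P Q R \<alpha> \<beta> \<gamma>] by (intro eq_matI) auto
  with part cl eq show ?thesis
    by (intro exI conjI)
qed

theorem corollary3:
  fixes s :: nat
    and A :: "nat \<Rightarrow> ('a, 'm) ring_scheme"
    and X :: "'x set"
  assumes "s \<ge> 1"
    and "\<And>i. i \<in> {1..s} \<Longrightarrow> cring (A i)"
    and "\<And>i. i \<in> {1..s} \<Longrightarrow> no_nontrivial_idempotents (A i)"
  shows "idempotents (matrix_ring 2 (power_series_ring (direct_sum_ring {1..s} A) X)) =
    {a. \<exists>P Q R \<alpha> \<beta> \<gamma>.
       P \<union> Q \<union> R = {1..s} \<and> P \<inter> Q = {} \<and> P \<inter> R = {} \<and> Q \<inter> R = {} \<and>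
       (let AP = power_series_ring (direct_sum_ring P A) X;
            AQ = power_series_ring (direct_sum_ring Q A) X;
            AR = power_series_ring (direct_sum_ring R A) X
        in \<alpha> \<in> carrier AP \<and> \<beta> \<in> carrier AP \<and> \<gamma> \<in> carrier AP \<and>
           \<alpha> \<otimes>\<^bsub>AP\<^esub> (\<one>\<^bsub>AP\<^esub> \<ominus>\<^bsub>AP\<^esub> \<alpha>) = \<beta> \<otimes>\<^bsub>AP\<^esub> \<gamma> \<and>
           a = triple_matrix X P Q R
                 (mat_of_rows_list 2 [[\<alpha>, \<beta>], [\<gamma>, \<one>\<^bsub>AP\<^esub> \<ominus>\<^bsub>AP\<^esub> \<alpha>]])
                 \<one>\<^bsub>matrix_ring 2 AQ\<^esub>
                 \<zero>\<^bsub>matrix_ring 2 AR\<^esub>)}"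
    (is "?idem = ?blocks")
proof
  show "?idem \<subseteq> ?blocks"
  proof
    fix a assume "a \<in> ?idem"
    then show "a \<in> ?blocks"
      using idempotent_eq_block_idempotent[of "{1..s}" A a X] assms(2,3)
      by (simp only: block_idempotent_def Let_def mem_Collect_eq)
  qed
  show "?blocks \<subseteq> ?idem"
  proof
    fix a assume "a \<in> ?blocks"
    then obtain P Q R \<alpha> \<beta> \<gamma> where part: "P \<union> Q \<union> R = {1..s}"
      and *: "\<alpha> \<in> carrier (power_series_ring (direct_sum_ring P A) X)"
        "\<beta> \<in> carrier (power_series_ring (direct_sum_ring P A) X)"
        "\<gamma> \<in> carrier (power_series_ring (direct_sum_ring P A) X)"
        "\<alpha> \<otimes>\<^bsub>power_series_ring (direct_sum_ring P A) X\<^esub>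
          (\<one>\<^bsub>power_series_ring (direct_sum_ring P A) X\<^esub>
            \<ominus>\<^bsub>power_series_ring (direct_sum_ring P A) X\<^esub> \<alpha>) =
          \<beta> \<otimes>\<^bsub>power_series_ring (direct_sum_ring P A) X\<^esub> \<gamma>"
      and a: "a = block_idempotent A X P Q R \<alpha> \<beta> \<gamma>"
      unfolding Let_def mem_Collect_eq
      by (elim exE conjE) (rule that, (simp only: block_idempotent_def Let_def)+)
    have "\<forall>i\<in>P \<union> Q \<union> R. cring (A i)"
      unfolding part using assms(2) by blast
    from block_idempotent_in_idempotents[OF this *] show "a \<in> ?idem"
      unfolding a part .
  qed
qed

end
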